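(* Consider a stochastic computation graph with a single cost function $f(\mathcal{Z})$, $\mathcal{Z} \subseteq \mathcal{X}$, and its Backprop-Q network, whose root is $Q_f := f$. Let $Q_{w_X}$ be a learned approximation (a function of the scope $Sc_X$) of the true Q-function $Q_X$ for every non-root node $Q_X$, and for the root let $Q_{w_f} := Q_f = f$. Let $\epsilon > 0$ and suppose that for every non-root node $Q_X$ and every parent $Q_Y$ of it in the Backprop-Q network (the root allowed as $Q_Y$), $$\mathbb{E}_{An_Y, Y}\big[\big(Q_{w_X}(Sc_X) - Q_{w_Y}(Sc_Y)\big)^2\big] \le \epsilon .$$ Then for every node $Q_X$, $$\mathbb{E}_{An_X, X}\Big[\big(Q_{w_X}(Sc_X) - Q_X(Sc_X)\big)^2\Big] \le \big(3\cdot 2^{\,l_{Q_X}-1} - 2\big)\,\epsilon \qquad \text{for } l_{Q_X} \ge 1,$$ where $Q_X(Sc_X)$ is the true expected cost and $l_{Q_X}$ is the length of a path in the Backprop-Q network from $Q_X$ to the root.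
   Context: A stochastic computation graph consists of a finite set $\mathcal{X}$ of random variables, a directed acyclic graph $\mathcal{G}_{\mathcal{X}}$ on $\mathcal{X}$, and conditional distributions $p_X(\cdot \mid Pa_X)$, $X\in\mathcal{X}$; the joint distribution is $\prod_{X} p_X(x\mid Pa_X)$. The cost $f$ is a real-valued function of the variables in $\mathcal{Z}\subseteq\mathcal{X}$, regarded as an additional terminal node with an edge from each variable in $\mathcal{Z}$. $Pa_X$ and $An_X$ denote the parents and the (strict) ancestors of $X$. Frontier: for $V \subseteq \mathcal{X}$, $Fr_V \subseteq V$ is the set of $v\in V$ for which there is a directed path from $v$ to the cost node all of whose intermediate nodes (if any) lie in $\mathcal{X}\setminus V$. Scope: $Sc_X := Fr_{An_X \cup \{X\}}$ for $X\in\mathcal{X}$, and $Sc_f := \mathcal{Z}$. True Q-functions: $Q_X(Sc_X) := \mathbb{E}[f(\mathcal{Z}) \mid Sc_X]$ for $X \in\mathcal{X}$, and $Q_f(\mathcal{Z}) := f(\mathcal{Z})$. Backprop-Q network: the directed acyclic graph whose nodes are the Q-functions $Q_X$ ($X \in \mathcal{X}$) together with the root $Q_f$, and whose edges are the reversed edges of $\mathcal{G}_{\mathcal{X}}$ with the cost node included; that is, $Q_Y$ is a parent of $Q_X$ when $X \in Pa_Y$, and $Q_f$ is a parent of $Q_X$ when $X\in\mathcal{Z}$. Only nodes connected to the root are considered. The length of a path is its number of edges. $\mathbb{E}_{An_Y,Y}$ is expectation over the joint distribution of the variables in $An_Y\cup\{Y\}$; when $Q_Y$ is the root $Q_f$,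 it is expectation over the joint distribution of $\mathcal{Z}$ and all ancestors of variables in $\mathcal{Z}$. All expectations written are assumed to exist. *)

theory Defs
  imports "HOL-Probability.Probability"
begin

section \<open>Stochastic computation graphs\<close>

text \<open>
  The variables are the elements of a finite set \<open>vars\<close>. Variable \<open>X\<close> takes values in the
  measurable space \<open>vspace X\<close> (only its carrier and its sigma-algebra matter), so an assignment of
  values to a set \<open>V\<close> of variables is a point of \<open>Pi\<^sub>M V vspace\<close>. The conditional distribution of
  \<open>X\<close> given its parents is an arbitrary probability kernel; mass functions and densities are
  special cases.
\<close>

record ('v, 'a) scg =
  vars :: "'v set"
  edges :: "('v \<times> 'v) set"
  vspace :: "'v \<Rightarrow> 'a measure"
  cond_distr :: "'v \<Rightarrow> ('v \<Rightarrow> 'a) \<Rightarrow> 'a measure"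
  cost_vars :: "'v set"
  cost :: "('v \<Rightarrow> 'a) \<Rightarrow> real"

definition parents :: "('v, 'a) scg \<Rightarrow> 'v \<Rightarrow> 'v set" where
  "parents G X = {Y. (Y, X) \<in> edges G}"

definition stochastic_computation_graph :: "('v, 'a) scg \<Rightarrow> bool" where
  "stochastic_computation_graph G \<longleftrightarrow>
     finite (vars G) \<and>
     edges G \<subseteq> vars G \<times> vars G \<and>
     acyclic (edges G) \<and>
     (\<forall>X\<in>vars G. cond_distr G X \<in>
        Pi\<^sub>M (parents G X) (vspace G) \<rightarrow>\<^sub>M prob_algebra (vspace G X)) \<and>
     cost_vars G \<subseteq> vars G \<and>
     cost G \<in> borel_measurable (Pi\<^sub>M (cost_vars G) (vspace G))"


section \<open>The joint distribution\<close>

text \<open>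
  The product of the conditional distributions is formed along an enumeration of the variables in
  which children stand before their parents: the head of the list is sampled last, given the values
  of its parents, which occur in the tail. Which enumeration is chosen is irrelevant, see
  \<open>joint_distribution_eq\<close> below.
\<close>

primrec sampling_order :: "('v, 'a) scg \<Rightarrow> 'v list \<Rightarrow> bool" where
  "sampling_order G [] \<longleftrightarrow> True"
| "sampling_order G (X # Xs) \<longleftrightarrow> X \<notin> set Xs \<and> parents G X \<subseteq> set Xs \<and> sampling_order G Xs"

definition extend_by :: "('v, 'a) scg \<Rightarrow> 'v set \<Rightarrow> 'v \<Rightarrow> ('v \<Rightarrow> 'a) \<Rightarrow> ('v \<Rightarrow> 'a) measure" where
  "extend_by G V X s =
     distr (cond_distr G X (restrict s (parents G X)))
       (Pi\<^sub>M (insert X V) (vspace G)) (\<lambda>x. s(X := x))"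

primrec kernel_product :: "('v, 'a) scg \<Rightarrow> 'v list \<Rightarrow> ('v \<Rightarrow> 'a) measure" where
  "kernel_product G [] = return (Pi\<^sub>M {} (vspace G)) (\<lambda>_. undefined)"
| "kernel_product G (X # Xs) = kernel_product G Xs \<bind> extend_by G (set Xs) X"

definition joint_distribution :: "('v, 'a) scg \<Rightarrow> ('v \<Rightarrow> 'a) measure" where
  "joint_distribution G =
     kernel_product G (SOME Xs. set Xs = vars G \<and> sampling_order G Xs)"

definition marginal :: "('v, 'a) scg \<Rightarrow> 'v set \<Rightarrow> ('v \<Rightarrow> 'a) measure" where
  "marginal G V = distr (joint_distribution G) (Pi\<^sub>M V (vspace G)) (\<lambda>s. restrict s V)"


section \<open>Ancestors, frontiers and scopes\<close>

text \<open>
  The nodes of the graph with the cost node included are \<open>Some X\<close> for a variable \<open>X\<close>, and \<open>None\<close>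
  for the cost node. A path is the list of its nodes; since the graphs are acyclic, the nodes of a
  path are automatically distinct.
\<close>

definition ext_edges :: "('v, 'a) scg \<Rightarrow> ('v option \<times> 'v option) set" where
  "ext_edges G = {(Some X, Some Y) | X Y. (X, Y) \<in> edges G} \<union> {(Some X, None) | X. X \<in> cost_vars G}"

definition directed_path :: "('n \<times> 'n) set \<Rightarrow> 'n \<Rightarrow> 'n list \<Rightarrow> 'n \<Rightarrow> bool" where
  "directed_path E u p v \<longleftrightarrow>
     p \<noteq> [] \<and> hd p = u \<and> last p = v \<and> successively (\<lambda>x y. (x, y) \<in> E) p"

definition path_length :: "'n list \<Rightarrow> nat" where
  "path_length p = length p - 1"

definition ancestors :: "('v, 'a) scg \<Rightarrow> 'v option \<Rightarrow> 'v set" where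
  "ancestors G n = {Y. (Some Y, n) \<in> (ext_edges G)\<^sup>+}"

text \<open>
  The variables over which the expectation belonging to a node is taken: \<open>An\<^sub>X \<union> {X}\<close> for a
  variable \<open>X\<close>, and for the cost node its arguments together with all their ancestors.
\<close>

definition closed_ancestors :: "('v, 'a) scg \<Rightarrow> 'v option \<Rightarrow> 'v set" where
  "closed_ancestors G n = ancestors G n \<union> set_option n"

definition frontier :: "('v, 'a) scg \<Rightarrow> 'v set \<Rightarrow> 'v set" where
  "frontier G V =
     {v \<in> V. \<exists>p. directed_path (ext_edges G) (Some v) p None \<and>
                 set (butlast (tl p)) \<subseteq> Some ` (vars G - V)}"

fun scope :: "('v, 'a) scg \<Rightarrow> 'v option \<Rightarrow> 'v set" where
  "scope G None = cost_vars G"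
| "scope G (Some X) = frontier G (closed_ancestors G (Some X))"


section \<open>Q-functions\<close>

definition sigma_of :: "('v, 'a) scg \<Rightarrow> 'v set \<Rightarrow> ('v \<Rightarrow> 'a) measure" where
  "sigma_of G V =
     vimage_algebra (space (joint_distribution G)) (\<lambda>s. restrict s V) (Pi\<^sub>M V (vspace G))"

text \<open>
  A conditional expectation is determined only almost everywhere. So \<open>q\<close> is \<^emph>\<open>a\<close> true Q-function of
  \<open>X\<close> if it is a measurable function on the assignments to the scope that yields a version of the
  conditional expectation of the cost given the scope.
\<close>

fun true_Q :: "('v, 'a) scg \<Rightarrow> 'v option \<Rightarrow> (('v \<Rightarrow> 'a) \<Rightarrow> real) \<Rightarrow> bool" where
  "true_Q G None q \<longleftrightarrow> q = cost G"
| "true_Q G (Some X) q \<longleftrightarrow>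
     q \<in> borel_measurable (Pi\<^sub>M (scope G (Some X)) (vspace G)) \<and>
     (AE s in joint_distribution G.
        q (restrict s (scope G (Some X))) =
        real_cond_exp (joint_distribution G) (sigma_of G (scope G (Some X)))
          (\<lambda>s. cost G (restrict s (cost_vars G))) s)"


section \<open>The Backprop-Q network\<close>

text \<open>
  The node \<open>n\<close> stands for the Q-function of \<open>n\<close>, with the root \<open>None\<close>. Edges lead from a parent to
  its children, the reverse of their direction in the computation graph.
\<close>

definition bq_nodes :: "('v, 'a) scg \<Rightarrow> 'v option set" where
  "bq_nodes G = {n. (None, n) \<in> ((ext_edges G)\<inverse>)\<^sup>*}"

definition bq_edges :: "('v, 'a) scg \<Rightarrow> ('v option \<times> 'v option) set" where
  "bq_edges G = (ext_edges G)\<inverse> \<inter> bq_nodes G \<times> bq_nodes G"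

definition sq_diff ::
  "('v, 'a) scg \<Rightarrow> ('v option \<Rightarrow> ('v \<Rightarrow> 'a) \<Rightarrow> real) \<Rightarrow> 'v option \<Rightarrow>
   ('v option \<Rightarrow> ('v \<Rightarrow> 'a) \<Rightarrow> real) \<Rightarrow> 'v option \<Rightarrow> ('v \<Rightarrow> 'a) \<Rightarrow> real" where
  "sq_diff G q m q' n s = (q m (restrict s (scope G m)) - q' n (restrict s (scope G n)))\<^sup>2"


section \<open>The joint distribution does not depend on the enumeration\<close>

lemma sampling_order_exists:
  assumes "finite V" "acyclic (edges G)" "\<And>X. X \<in> V \<Longrightarrow> parents G X \<subseteq> V"
  shows "\<exists>Xs. set Xs = V \<and> sampling_order G Xs"
  using assms(1,3)
proof (induction V rule: finite_psubset_induct)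
  case (psubset V)
  show ?case
  proof (cases "V = {}")
    case True
    then show ?thesis by (auto intro: exI[of _ "[]"])
  next
    case False
    let ?E = "(edges G \<inter> V \<times> V)\<inverse>"
    have ac: "acyclic (edges G \<inter> V \<times> V)"
      using assms(2) by (rule acyclic_subset) auto
    have "finite (edges G \<inter> V \<times> V)" using psubset.hyps by simp
    then have "wf ?E" using ac by (rule finite_acyclic_wf_converse)
    moreover obtain X\<^sub>0 where "X\<^sub>0 \<in> V" using False by blast
    ultimately obtain X where X: "X \<in> V" "\<And>Y. (Y, X) \<in> ?E \<Longrightarrow> Y \<notin> V"
      by (rule wfE_min) blast
    have noch: "X \<notin> parents G Y" if "Y \<in> V" for Y
      using X(1) X(2)[of Y] that by (auto simp: parents_def)
    have "V - {X} \<subset> V" using X(1) by blast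
    moreover have closed: "parents G Y \<subseteq> V - {X}" if "Y \<in> V" for Y
      using psubset.prems[OF that] noch[OF that] by blast
    ultimately obtain Xs where Xs: "set Xs = V - {X}" "sampling_order G Xs"
      using psubset.IH[of "V - {X}"] by blast
    then have "set (X # Xs) = V" "sampling_order G (X # Xs)"
      using X(1) closed[OF X(1)] by (simp_all add: insert_absorb)
    then show ?thesis by blast
  qed
qed

context
  fixes G :: "('v, 'a) scg"
begin

definition is_kernel :: "'v \<Rightarrow> bool" where
  "is_kernel X \<longleftrightarrow>
     cond_distr G X \<in> Pi\<^sub>M (parents G X) (vspace G) \<rightarrow>\<^sub>M prob_algebra (vspace G X)"

lemma measurable_cond_distr_restrict:
  assumes K: "is_kernel X" and pa: "parents G X \<subseteq> V"
  shows "(\<lambda>s. cond_distr G X (restrict s (parents G X)))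
      \<in> Pi\<^sub>M V (vspace G) \<rightarrow>\<^sub>M prob_algebra (vspace G X)"
  by (rule measurable_compose[OF measurable_restrict_subset[OF pa] K[unfolded is_kernel_def]])

lemma measurable_extend_by:
  assumes K: "is_kernel X" and pa: "parents G X \<subseteq> V"
  shows "extend_by G V X \<in> Pi\<^sub>M V (vspace G) \<rightarrow>\<^sub>M prob_algebra (Pi\<^sub>M (insert X V) (vspace G))"
  unfolding extend_by_def[abs_def]
  by (intro measurable_distr_prob_space2[where M="vspace G X"]
        measurable_cond_distr_restrict[OF assms] measurable_add_dim)

lemma kernel_product_in_space:
  assumes "\<And>X. X \<in> set Xs \<Longrightarrow> is_kernel X" "sampling_order G Xs"
  shows "kernel_product G Xs \<in> space (prob_algebra (Pi\<^sub>M (set Xs) (vspace G)))"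
  using assms
proof (induction Xs)
  case Nil
  then show ?case
    by (auto simp: space_prob_algebra space_PiM intro!: prob_space_return)
next
  case (Cons X Xs)
  then have "extend_by G (set Xs) X
      \<in> Pi\<^sub>M (set Xs) (vspace G) \<rightarrow>\<^sub>M prob_algebra (Pi\<^sub>M (set (X # Xs)) (vspace G))"
    by (simp add: measurable_extend_by)
  with Cons show ?case
    by (simp add: space_prob_algebra prob_space_bind' sets_bind')
qed

lemma extend_by_twice:
  assumes X: "is_kernel X" "parents G X \<subseteq> V" and Y: "is_kernel Y" "parents G Y \<subseteq> V"
    and "X \<notin> V" and s: "s \<in> space (Pi\<^sub>M V (vspace G))"
  shows "extend_by G V X s \<bind> extend_by G (insert X V) Y =
    cond_distr G X (restrict s (parents G X)) \<bind> (\<lambda>x.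
    cond_distr G Y (restrict s (parents G Y)) \<bind> (\<lambda>y.
      return (Pi\<^sub>M (insert Y (insert X V)) (vspace G)) (s(X := x, Y := y))))"
proof -
  let ?KX = "cond_distr G X (restrict s (parents G X))"
  let ?KY = "cond_distr G Y (restrict s (parents G Y))"
  have KX: "?KX \<in> space (prob_algebra (vspace G X))"
    by (rule measurable_space[OF measurable_cond_distr_restrict[OF X] s])
  have KY: "?KY \<in> space (prob_algebra (vspace G Y))"
    by (rule measurable_space[OF measurable_cond_distr_restrict[OF Y] s])
  have setsX: "sets ?KX = sets (vspace G X)" and setsY: "sets ?KY = sets (vspace G Y)"
    using KX KY by (auto simp: space_prob_algebra)
  note [measurable_cong] = setsX setsY
  have neX: "space ?KX \<noteq> {}" and neY: "space ?KY \<noteq> {}"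
    using KX KY by (auto simp: space_prob_algebra dest: prob_space.not_empty)
  have updX: "(\<lambda>x. s(X := x)) \<in> ?KX \<rightarrow>\<^sub>M Pi\<^sub>M (insert X V) (vspace G)"
    by (rule measurable_fun_upd[where J=V]) (use s in \<open>auto simp: setsX cong: measurable_cong_sets\<close>)
  have ext: "extend_by G (insert X V) Y \<in> Pi\<^sub>M (insert X V) (vspace G) \<rightarrow>\<^sub>M
      subprob_algebra (Pi\<^sub>M (insert Y (insert X V)) (vspace G))"
    using Y by (intro measurable_prob_algebraD measurable_extend_by) auto
  have "extend_by G (insert X V) Y (s(X := x)) =
      ?KY \<bind> (\<lambda>y. return (Pi\<^sub>M (insert Y (insert X V)) (vspace G)) (s(X := x, Y := y)))"
    if x: "x \<in> space ?KX" for x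
  proof -
    have "restrict (s(X := x)) (parents G Y) = restrict s (parents G Y)"
      using assms by (auto simp: restrict_def fun_eq_iff)
    moreover have "(\<lambda>y. s(X := x, Y := y)) \<in> ?KY \<rightarrow>\<^sub>M Pi\<^sub>M (insert Y (insert X V)) (vspace G)"
    proof (rule measurable_fun_upd[where J="insert X V"])
      show "(\<lambda>y. s(X := x)) \<in> ?KY \<rightarrow>\<^sub>M Pi\<^sub>M (insert X V) (vspace G)"
        using measurable_space[OF updX x] by (rule measurable_const)
      show "(\<lambda>y. y) \<in> ?KY \<rightarrow>\<^sub>M vspace G Y"
        using setsY by (rule measurable_ident_sets)
    qed auto
    ultimately show ?thesis
      by (simp add: extend_by_def bind_return_distr'[OF neY])
  qed
  then show ?thesis
    unfolding extend_by_def[of G V X s]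
    by (subst bind_distr[OF updX ext neX]) (auto intro!: bind_cong)
qed

lemma extend_by_commute:
  assumes X: "is_kernel X" "parents G X \<subseteq> V" and Y: "is_kernel Y" "parents G Y \<subseteq> V"
    and "X \<notin> V" "Y \<notin> V" "X \<noteq> Y" and s: "s \<in> space (Pi\<^sub>M V (vspace G))"
  shows "extend_by G V X s \<bind> extend_by G (insert X V) Y =
         extend_by G V Y s \<bind> extend_by G (insert Y V) X"
proof -
  let ?KX = "cond_distr G X (restrict s (parents G X))"
  let ?KY = "cond_distr G Y (restrict s (parents G Y))"
  let ?P = "Pi\<^sub>M (insert Y (insert X V)) (vspace G)"
  have KX: "?KX \<in> space (prob_algebra (vspace G X))"
    by (rule measurable_space[OF measurable_cond_distr_restrict[OF X] s])
  have KY: "?KY \<in> space (prob_algebra (vspace G Y))"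
    by (rule measurable_space[OF measurable_cond_distr_restrict[OF Y] s])
  have setsX: "sets ?KX = sets (vspace G X)" and setsY: "sets ?KY = sets (vspace G Y)"
    using KX KY by (auto simp: space_prob_algebra)
  interpret pX: prob_space ?KX using KX by (simp add: space_prob_algebra)
  interpret pY: prob_space ?KY using KY by (simp add: space_prob_algebra)
  interpret pair_prob_space ?KX ?KY ..
  have m1: "fst \<in> ?KX \<Otimes>\<^sub>M ?KY \<rightarrow>\<^sub>M vspace G X" and m2: "snd \<in> ?KX \<Otimes>\<^sub>M ?KY \<rightarrow>\<^sub>M vspace G Y"
    using measurable_fst[of ?KX ?KY] measurable_snd[of ?KX ?KY] setsX setsY
    by (auto cong: measurable_cong_sets)
  have "(\<lambda>p. s(X := fst p)) \<in> ?KX \<Otimes>\<^sub>M ?KY \<rightarrow>\<^sub>M Pi\<^sub>M (insert X V) (vspace G)"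
    by (rule measurable_fun_upd[where J=V]) (use s m1 in auto)
  then have "(\<lambda>p. (s(X := fst p))(Y := snd p)) \<in> ?KX \<Otimes>\<^sub>M ?KY \<rightarrow>\<^sub>M ?P"
    by (rule measurable_fun_upd[where J="insert X V", rotated]) (use m2 in auto)
  then have C: "(\<lambda>(x, y). return ?P (s(X := x, Y := y))) \<in> ?KX \<Otimes>\<^sub>M ?KY \<rightarrow>\<^sub>M subprob_algebra ?P"
    by (simp add: case_prod_beta' measurable_compose[OF _ return_measurable])
  show ?thesis
    using assms bind_rotate[OF C]
    by (simp add: extend_by_twice fun_upd_twist[OF \<open>X \<noteq> Y\<close>] insert_commute[of Y X])
qed

lemma kernel_product_move:
  assumes "\<And>Y. Y \<in> set (A @ X # B) \<Longrightarrow> is_kernel Y" "sampling_order G (A @ X # B)"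
    and "\<And>Y. Y \<in> set A \<Longrightarrow> X \<notin> parents G Y"
  shows "kernel_product G (A @ X # B) = kernel_product G (X # A @ B) \<and> sampling_order G (X # A @ B)"
  using assms
proof (induction A)
  case Nil
  then show ?case by simp
next
  case (Cons Y A)
  let ?V = "set (A @ B)"
  have IH: "kernel_product G (A @ X # B) = kernel_product G (X # A @ B)"
    and so: "sampling_order G (X # A @ B)"
    using Cons by auto
  have Y: "is_kernel Y" "parents G Y \<subseteq> ?V" "Y \<notin> ?V" "Y \<noteq> X"
    using Cons.prems by auto
  have X: "is_kernel X" "parents G X \<subseteq> ?V" "X \<notin> ?V"
    using Cons.prems(1) so by auto
  have P: "kernel_product G (A @ B) \<in> space (prob_algebra (Pi\<^sub>M ?V (vspace G)))"
    using Cons.prems(1) so by (intro kernel_product_in_space) auto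
  then have sp: "sets (kernel_product G (A @ B)) = sets (Pi\<^sub>M ?V (vspace G))"
    by (simp add: space_prob_algebra)
  have assoc: "kernel_product G (A @ B) \<bind> extend_by G ?V U \<bind> extend_by G (insert U ?V) W =
      kernel_product G (A @ B) \<bind> (\<lambda>s. extend_by G ?V U s \<bind> extend_by G (insert U ?V) W)"
    if "is_kernel U" "parents G U \<subseteq> ?V" "is_kernel W" "parents G W \<subseteq> ?V" for U W
  proof (rule bind_assoc)
    have "extend_by G ?V U \<in> Pi\<^sub>M ?V (vspace G) \<rightarrow>\<^sub>M subprob_algebra (Pi\<^sub>M (insert U ?V) (vspace G))"
      using that by (intro measurable_prob_algebraD measurable_extend_by)
    then show "extend_by G ?V U \<in> kernel_product G (A @ B) \<rightarrow>\<^sub>M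
        subprob_algebra (Pi\<^sub>M (insert U ?V) (vspace G))"
      by (simp add: measurable_cong_sets[OF sp refl])
    show "extend_by G (insert U ?V) W \<in> Pi\<^sub>M (insert U ?V) (vspace G) \<rightarrow>\<^sub>M
        subprob_algebra (Pi\<^sub>M (insert W (insert U ?V)) (vspace G))"
      using that by (intro measurable_prob_algebraD measurable_extend_by) auto
  qed
  have "kernel_product G ((Y # A) @ X # B) =
      kernel_product G (A @ B) \<bind> extend_by G ?V X \<bind> extend_by G (insert X ?V) Y"
    using IH by simp
  also have "\<dots> = kernel_product G (A @ B) \<bind> (\<lambda>s. extend_by G ?V X s \<bind> extend_by G (insert X ?V) Y)"
    using X Y by (intro assoc)
  also have "\<dots> = kernel_product G (A @ B) \<bind> (\<lambda>s. extend_by G ?V Y s \<bind> extend_by G (insert Y ?V) X)"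
    using X Y sets_eq_imp_space_eq[OF sp] by (intro bind_cong refl extend_by_commute) auto
  also have "\<dots> = kernel_product G (A @ B) \<bind> extend_by G ?V Y \<bind> extend_by G (insert Y ?V) X"
    using X Y by (intro assoc[symmetric])
  finally show ?case
    using X Y so by auto
qed

lemma kernel_product_unique:
  assumes "\<And>X. X \<in> set Xs \<Longrightarrow> is_kernel X" "sampling_order G Xs" "sampling_order G Ys"
    and "set Xs = set Ys"
  shows "kernel_product G Xs = kernel_product G Ys"
  using assms
proof (induction Xs arbitrary: Ys)
  case Nil
  then show ?case by simp
next
  case (Cons X Xs)
  have par: "parents G Y \<subseteq> set Zs" if "sampling_order G Zs" "Y \<in> set Zs" for Y Zs
    using that by (induction Zs) auto
  obtain A B where Ys: "Ys = A @ X # B"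
    using Cons.prems(4) by (metis list.set_intros(1) split_list)
  have dist: "distinct Ys"
  proof -
    have "distinct Zs" if "sampling_order G Zs" for Zs using that by (induction Zs) auto
    then show ?thesis using Cons.prems by simp
  qed
  have AB: "set (A @ B) = set Xs"
    using Cons.prems(2,4) dist Ys insert_ident[of X "set (A @ B)" "set Xs"] by auto
  have "X \<notin> parents G Y" if "Y \<in> set A" for Y
    using par[of Xs Y] Cons.prems AB that by auto
  then have move: "kernel_product G Ys = kernel_product G (X # A @ B)" "sampling_order G (X # A @ B)"
    using Cons.prems Ys kernel_product_move[of A X B] by auto
  have "kernel_product G Xs = kernel_product G (A @ B)"
    using Cons move AB by auto
  then show ?case using move(1) AB by simp
qed

end

theorem joint_distribution_eq:
  assumes "stochastic_computation_graph G" "set Xs = vars G" "sampling_order G Xs"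
  shows "joint_distribution G = kernel_product G Xs"
proof -
  have "\<exists>Xs. set Xs = vars G \<and> sampling_order G Xs"
    using assms(1) by (intro sampling_order_exists)
      (auto simp: stochastic_computation_graph_def parents_def)
  then have "set (SOME Xs. set Xs = vars G \<and> sampling_order G Xs) = vars G \<and>
      sampling_order G (SOME Xs. set Xs = vars G \<and> sampling_order G Xs)"
    by (rule someI_ex)
  then show ?thesis
    unfolding joint_distribution_def
    using assms by (intro kernel_product_unique)
      (auto simp: stochastic_computation_graph_def is_kernel_def)
qed

end

theory Submission
  imports Defs
begin

text \<open>
  The frontier of a set \<open>V\<close> of variables that is closed under parents separates \<open>V\<close> from the cost:
  if the variables outside \<open>V\<close> are sampled after those in \<open>V\<close>, integrating them out of the cost one
  by one leaves a function of the frontier only. So a true Q-function \<open>Q\<^sub>X\<close> is also the conditional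
  expectation of the cost given all of \<open>An\<^sub>X \<union> {X}\<close>, and the tower property yields
  \<open>Q\<^sub>X = E[Q\<^sub>Y | An\<^sub>X, X]\<close> for every parent \<open>Q\<^sub>Y\<close> of \<open>Q\<^sub>X\<close> in the Backprop-Q network. By Jensen's
  inequality, the error of \<open>X\<close> is at most the mean square of \<open>Qw\<^sub>X - Q\<^sub>Y\<close>. This is at most
  \<open>\<epsilon>\<close> if \<open>Y\<close> is the root; in general it is at most \<open>2 * \<epsilon>\<close> plus twice the error of \<open>Y\<close>, and
  \<open>3 * 2 ^ (l - 1) - 2\<close> solves the recursion \<open>b 1 = 1\<close>, \<open>b (l + 1) = 2 + 2 * b l\<close>.
\<close>

section \<open>Integration against the kernel product, one variable at a time\<close>

text \<open>Fubini for one sampling step: the integral over a bind is an iterated integral, and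
  \<open>extend_by\<close> is the image of the conditional distribution of \<open>X\<close> under
  the update of \<open>s\<close> at \<open>X\<close>.\<close>

lemma nn_integral_kernel_product_Cons:
  assumes K: "\<And>Y. Y \<in> set (X # Xs) \<Longrightarrow> is_kernel G Y" and so: "sampling_order G (X # Xs)"
    and F: "F \<in> borel_measurable (Pi\<^sub>M (set (X # Xs)) (vspace G))"
  shows "(\<integral>\<^sup>+ s. F s \<partial>kernel_product G (X # Xs)) =
    (\<integral>\<^sup>+ s. (\<integral>\<^sup>+ x. F (s(X := x)) \<partial>cond_distr G X (restrict s (parents G X))) \<partial>kernel_product G Xs)"
proof -
  have pa: "parents G X \<subseteq> set Xs" and KX: "is_kernel G X" using so K by auto
  have sp: "sets (kernel_product G Xs) = sets (Pi\<^sub>M (set Xs) (vspace G))"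
    using kernel_product_in_space[of Xs G] K so by (simp add: space_prob_algebra)
  note [measurable_cong] = sp
  have ext: "extend_by G (set Xs) X \<in> kernel_product G Xs \<rightarrow>\<^sub>M
      subprob_algebra (Pi\<^sub>M (insert X (set Xs)) (vspace G))"
    using measurable_prob_algebraD[OF measurable_extend_by[OF KX pa]] by measurable
  have extend_by_eq: "(\<integral>\<^sup>+ t. F t \<partial>extend_by G (set Xs) X s) =
      (\<integral>\<^sup>+ x. F (s(X := x)) \<partial>cond_distr G X (restrict s (parents G X)))"
    if "s \<in> space (kernel_product G Xs)" for s
  proof -
    have s: "s \<in> space (Pi\<^sub>M (set Xs) (vspace G))"
      using that sets_eq_imp_space_eq[OF sp] by simp
    have "cond_distr G X (restrict s (parents G X)) \<in> space (prob_algebra (vspace G X))"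
      by (rule measurable_space[OF measurable_cond_distr_restrict[OF KX pa] s])
    then have [measurable_cong]: "sets (cond_distr G X (restrict s (parents G X))) = sets (vspace G X)"
      by (simp add: space_prob_algebra)
    have "(\<lambda>x. s(X := x)) \<in> cond_distr G X (restrict s (parents G X)) \<rightarrow>\<^sub>M
        Pi\<^sub>M (insert X (set Xs)) (vspace G)"
      by (rule measurable_fun_upd[where J="set Xs"]) (use s in measurable)
    then show ?thesis
      using F by (simp add: extend_by_def nn_integral_distr)
  qed
  have "(\<integral>\<^sup>+ s. F s \<partial>kernel_product G (X # Xs)) =
      (\<integral>\<^sup>+ s. (\<integral>\<^sup>+ t. F t \<partial>extend_by G (set Xs) X s) \<partial>kernel_product G Xs)"
    unfolding kernel_product.simps by (rule nn_integral_bind[OF _ ext]) (use F in simp)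
  also have "\<dots> =
    (\<integral>\<^sup>+ s. (\<integral>\<^sup>+ x. F (s(X := x)) \<partial>cond_distr G X (restrict s (parents G X))) \<partial>kernel_product G Xs)"
    by (rule nn_integral_cong) (rule extend_by_eq)
  finally show ?thesis .
qed

text \<open>The conditional distribution of \<open>X\<close> has total mass one, so it disappears
  when the integrand does not read \<open>X\<close>.\<close>

lemma nn_integral_kernel_product_Cons_indep:
  assumes K: "\<And>Y. Y \<in> set (X # Xs) \<Longrightarrow> is_kernel G Y" and so: "sampling_order G (X # Xs)"
    and F: "F \<in> borel_measurable (Pi\<^sub>M (set Xs) (vspace G))"
  shows "(\<integral>\<^sup>+ s. F (restrict s (set Xs)) \<partial>kernel_product G (X # Xs)) =
    (\<integral>\<^sup>+ s. F s \<partial>kernel_product G Xs)"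
proof -
  have pa: "parents G X \<subseteq> set Xs" and KX: "is_kernel G X" and X: "X \<notin> set Xs" using so K by auto
  have sp: "sets (kernel_product G Xs) = sets (Pi\<^sub>M (set Xs) (vspace G))"
    using kernel_product_in_space[of Xs G] K so by (simp add: space_prob_algebra)
  have "(\<integral>\<^sup>+ x. F (restrict (s(X := x)) (set Xs)) \<partial>cond_distr G X (restrict s (parents G X))) = F s"
    if "s \<in> space (kernel_product G Xs)" for s
  proof -
    have s: "s \<in> space (Pi\<^sub>M (set Xs) (vspace G))"
      using that sets_eq_imp_space_eq[OF sp] by simp
    have "cond_distr G X (restrict s (parents G X)) \<in> space (prob_algebra (vspace G X))"
      by (rule measurable_space[OF measurable_cond_distr_restrict[OF KX pa] s])
    then have "emeasure (cond_distr G X (restrict s (parents G X)))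
        (space (cond_distr G X (restrict s (parents G X)))) = 1"
      by (simp add: space_prob_algebra prob_space.emeasure_space_1)
    moreover have "restrict (s(X := x)) (set Xs) = s" for x
      using s X by (auto simp: space_PiM PiE_def extensional_def fun_eq_iff)
    ultimately show ?thesis by simp
  qed
  moreover have "(\<lambda>s. F (restrict s (set Xs))) \<in> borel_measurable (Pi\<^sub>M (set (X # Xs)) (vspace G))"
    by (rule measurable_compose[OF measurable_restrict_subset F]) auto
  ultimately show ?thesis
    by (subst nn_integral_kernel_product_Cons[OF K so]) (auto cong: nn_integral_cong)
qed

text \<open>The variables of \<open>Ls\<close> are integrated out of \<open>h\<close>, last sampled
  first. Averaging over some \<open>u\<close> in \<open>C\<close> brings in only the parents of
  \<open>u\<close>, which lie in \<open>C\<close> already, so that finally only \<open>C\<close>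
  within \<open>Vs\<close> is read. The factor \<open>a\<close> is a test function, constant
  throughout; the identity says that \<open>g\<close> represents the conditional expectation of
  \<open>h\<close> given \<open>Vs\<close>.\<close>

lemma kernel_product_conditional:
  fixes h :: "('v \<Rightarrow> 'a) \<Rightarrow> ennreal" and G :: "('v, 'a) scg"
  assumes "\<And>Y. Y \<in> set (Ls @ Vs) \<Longrightarrow> is_kernel G Y" "sampling_order G (Ls @ Vs)"
    and "C \<subseteq> set (Ls @ Vs)" "\<And>u. u \<in> C \<Longrightarrow> u \<in> set Ls \<Longrightarrow> parents G u \<subseteq> C"
    and "h \<in> borel_measurable (Pi\<^sub>M C (vspace G))"
  shows "\<exists>g \<in> borel_measurable (Pi\<^sub>M (C \<inter> set Vs) (vspace G)).
    \<forall>a \<in> borel_measurable (Pi\<^sub>M (set Vs) (vspace G)).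
      (\<integral>\<^sup>+ s. a (restrict s (set Vs)) * h (restrict s C) \<partial>kernel_product G (Ls @ Vs)) =
      (\<integral>\<^sup>+ s. a (restrict s (set Vs)) * g (restrict s (C \<inter> set Vs)) \<partial>kernel_product G (Ls @ Vs))"
  using assms
proof (induction Ls arbitrary: C h)
  case Nil
  then have "C \<inter> set Vs = C" by auto
  then show ?case using Nil by auto
next
  case (Cons u Ls)
  let ?V = "set Vs" and ?W = "set (Ls @ Vs)"
  have u: "u \<notin> ?W" "parents G u \<subseteq> ?W" "is_kernel G u"
    and so: "sampling_order G (Ls @ Vs)"
    and K: "\<And>Y. Y \<in> set (Ls @ Vs) \<Longrightarrow> is_kernel G Y"
    using Cons.prems by auto
  have par: "parents G Y \<subseteq> set Zs" if "sampling_order G Zs" "Y \<in> set Zs" for Y Zs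
    using that by (induction Zs) auto
  define C' where "C' = C - {u}"
  have C': "C' \<subseteq> ?W" "C' \<inter> ?V = C \<inter> ?V" using Cons.prems(3) u by (auto simp: C'_def)
  \<comment> \<open>\<open>u\<close> is sampled after \<open>w\<close>, so it is not a parent of
    \<open>w\<close>, and removing it from \<open>C\<close> keeps the closure.\<close>
  have closed: "parents G w \<subseteq> C'" if "w \<in> C'" "w \<in> set Ls" for w
    using Cons.prems(4)[of w] par[OF so, of w] that u by (auto simp: C'_def)
  have sp: "sets (kernel_product G (Ls @ Vs)) = sets (Pi\<^sub>M ?W (vspace G))"
    using kernel_product_in_space[of "Ls @ Vs" G] Cons.prems(1) so by (simp add: space_prob_algebra)
  have "\<exists>h' \<in> borel_measurable (Pi\<^sub>M C' (vspace G)). \<forall>a \<in> borel_measurable (Pi\<^sub>M ?V (vspace G)).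
      (\<integral>\<^sup>+ s. a (restrict s ?V) * h (restrict s C) \<partial>kernel_product G (u # Ls @ Vs)) =
      (\<integral>\<^sup>+ s. a (restrict s ?V) * h' (restrict s C') \<partial>kernel_product G (Ls @ Vs))"
  proof (cases "u \<in> C")
    case True
    then have pa: "parents G u \<subseteq> C'"
      using Cons.prems(4)[of u] u by (auto simp: C'_def)
    have ins: "insert u C' = C" using True by (auto simp: C'_def)
    \<comment> \<open>The mean of \<open>h\<close> over \<open>u\<close>. The kernel reads only the
      parents of \<open>u\<close>, which belong to \<open>C'\<close>, so this is a function on
      assignments to \<open>C'\<close>.\<close>
    define h' where "h' r = (\<integral>\<^sup>+ x. h (r(u := x)) \<partial>cond_distr G u (restrict r (parents G u)))" for r
    have upd: "(\<lambda>p. (fst p)(u := snd p)) \<in> Pi\<^sub>M C' (vspace G) \<Otimes>\<^sub>M vspace G u \<rightarrow>\<^sub>M Pi\<^sub>M C (vspace G)"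
      by (rule measurable_fun_upd[where J=C']) (use ins in auto)
    have h': "h' \<in> borel_measurable (Pi\<^sub>M C' (vspace G))"
      unfolding h'_def
    proof (rule nn_integral_measurable_subprob_algebra2)
      show "(\<lambda>(r, x). h (r(u := x))) \<in> borel_measurable (Pi\<^sub>M C' (vspace G) \<Otimes>\<^sub>M vspace G u)"
        unfolding case_prod_beta' by (rule measurable_compose[OF upd Cons.prems(5)])
      show "(\<lambda>r. cond_distr G u (restrict r (parents G u)))
          \<in> Pi\<^sub>M C' (vspace G) \<rightarrow>\<^sub>M subprob_algebra (vspace G u)"
        by (intro measurable_prob_algebraD measurable_cond_distr_restrict u pa)
    qed
    show ?thesis
    proof (intro bexI[OF _ h'] ballI)
      fix a :: "('v \<Rightarrow> 'a) \<Rightarrow> ennreal" assume a: "a \<in> borel_measurable (Pi\<^sub>M ?V (vspace G))"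
      have m: "(\<lambda>s. a (restrict s ?V) * h (restrict s C))
          \<in> borel_measurable (Pi\<^sub>M (set (u # Ls @ Vs)) (vspace G))"
        using Cons.prems(3)
        by (intro borel_measurable_times_ennreal measurable_compose[OF measurable_restrict_subset a]
              measurable_compose[OF measurable_restrict_subset Cons.prems(5)]) auto
      have "(\<integral>\<^sup>+ x. a (restrict (s(u := x)) ?V) * h (restrict (s(u := x)) C)
            \<partial>cond_distr G u (restrict s (parents G u))) = a (restrict s ?V) * h' (restrict s C')"
        if "s \<in> space (kernel_product G (Ls @ Vs))" for s
      proof -
        have s: "s \<in> space (Pi\<^sub>M ?W (vspace G))"
          using that sets_eq_imp_space_eq[OF sp] by simp
        then have s': "restrict s C' \<in> space (Pi\<^sub>M C' (vspace G))"
          using C' by (auto simp: space_PiM)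
        have "cond_distr G u (restrict s (parents G u)) \<in> space (prob_algebra (vspace G u))"
          by (rule measurable_space[OF measurable_cond_distr_restrict[OF u(3,2)] s])
        then have [measurable_cong]: "sets (cond_distr G u (restrict s (parents G u))) = sets (vspace G u)"
          by (simp add: space_prob_algebra)
        have "(\<lambda>x. (restrict s C')(u := x)) \<in> cond_distr G u (restrict s (parents G u)) \<rightarrow>\<^sub>M
            Pi\<^sub>M C (vspace G)"
        proof (rule measurable_fun_upd[where J=C'])
          show "(\<lambda>x. restrict s C') \<in> cond_distr G u (restrict s (parents G u)) \<rightarrow>\<^sub>M
              Pi\<^sub>M C' (vspace G)"
            using s' by (rule measurable_const)
          show "(\<lambda>x. x) \<in> cond_distr G u (restrict s (parents G u)) \<rightarrow>\<^sub>M vspace G u"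
            by measurable
        qed (use ins in auto)
        then have mx: "(\<lambda>x. h ((restrict s C')(u := x)))
            \<in> borel_measurable (cond_distr G u (restrict s (parents G u)))"
          by (rule measurable_compose) (rule Cons.prems(5))
        have e1: "restrict (s(u := x)) ?V = restrict s ?V"
          and e2: "restrict (s(u := x)) C = (restrict s C')(u := x)" for x
          using u True by (auto simp: C'_def fun_eq_iff)
        \<comment> \<open>The factor \<open>a\<close> does not depend on \<open>x\<close> and is
          pulled out; by \<open>pa\<close>, restricting to \<open>C'\<close> leaves the values of
          the parents of \<open>u\<close> intact.\<close>
        show ?thesis
          using mx by (simp add: e1 e2 h'_def Int_absorb1[OF pa] nn_integral_cmult)
      qed
      then show "(\<integral>\<^sup>+ s. a (restrict s ?V) * h (restrict s C) \<partial>kernel_product G (u # Ls @ Vs)) =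
          (\<integral>\<^sup>+ s. a (restrict s ?V) * h' (restrict s C') \<partial>kernel_product G (Ls @ Vs))"
        using Cons.prems(1,2) m
        by (subst nn_integral_kernel_product_Cons) (auto cong: nn_integral_cong)
    qed
  next
    case False
    \<comment> \<open>Here \<open>h\<close> does not read \<open>u\<close>, so \<open>h\<close>
      itself serves as \<open>h'\<close>.\<close>
    then have CC: "C' = C" by (auto simp: C'_def)
    show ?thesis
    proof (intro bexI[of _ h] ballI)
      show "h \<in> borel_measurable (Pi\<^sub>M C' (vspace G))" using Cons.prems(5) CC by simp
      fix a :: "('v \<Rightarrow> 'a) \<Rightarrow> ennreal" assume a: "a \<in> borel_measurable (Pi\<^sub>M ?V (vspace G))"
      have m: "(\<lambda>s. a (restrict s ?V) * h (restrict s C)) \<in> borel_measurable (Pi\<^sub>M ?W (vspace G))"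
        using C' CC
        by (intro borel_measurable_times_ennreal measurable_compose[OF measurable_restrict_subset a]
              measurable_compose[OF measurable_restrict_subset Cons.prems(5)]) auto
      have e: "restrict (restrict s ?W) ?V = restrict s ?V" "restrict (restrict s ?W) C = restrict s C" for s
        using C' CC by (auto simp: fun_eq_iff)
      show "(\<integral>\<^sup>+ s. a (restrict s ?V) * h (restrict s C) \<partial>kernel_product G (u # Ls @ Vs)) =
          (\<integral>\<^sup>+ s. a (restrict s ?V) * h (restrict s C') \<partial>kernel_product G (Ls @ Vs))"
        using nn_integral_kernel_product_Cons_indep[OF _ _ m, of u] Cons.prems(1,2)
        unfolding e by (simp add: CC)
    qed
  qed
  then obtain h' where h': "h' \<in> borel_measurable (Pi\<^sub>M C' (vspace G))"
    and step: "\<And>a. a \<in> borel_measurable (Pi\<^sub>M ?V (vspace G)) \<Longrightarrow>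
      (\<integral>\<^sup>+ s. a (restrict s ?V) * h (restrict s C) \<partial>kernel_product G (u # Ls @ Vs)) =
      (\<integral>\<^sup>+ s. a (restrict s ?V) * h' (restrict s C') \<partial>kernel_product G (Ls @ Vs))"
    by blast
  obtain g where g: "g \<in> borel_measurable (Pi\<^sub>M (C \<inter> ?V) (vspace G))"
    and IH: "\<And>a. a \<in> borel_measurable (Pi\<^sub>M ?V (vspace G)) \<Longrightarrow>
      (\<integral>\<^sup>+ s. a (restrict s ?V) * h' (restrict s C') \<partial>kernel_product G (Ls @ Vs)) =
      (\<integral>\<^sup>+ s. a (restrict s ?V) * g (restrict s (C \<inter> ?V)) \<partial>kernel_product G (Ls @ Vs))"
    using Cons.IH[OF K so C'(1) closed h'] unfolding C'(2) by blast
  show ?case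
  \<comment> \<open>The induction hypothesis speaks of the product without \<open>u\<close>. Neither
    \<open>a\<close> nor \<open>g\<close> reads \<open>u\<close>, so the right-hand side can be
    lifted back to the full product.\<close>
  proof (intro bexI[OF _ g] ballI)
    fix a :: "('v \<Rightarrow> 'a) \<Rightarrow> ennreal" assume a: "a \<in> borel_measurable (Pi\<^sub>M ?V (vspace G))"
    have m: "(\<lambda>s. a (restrict s ?V) * g (restrict s (C \<inter> ?V))) \<in> borel_measurable (Pi\<^sub>M ?W (vspace G))"
      by (intro borel_measurable_times_ennreal measurable_compose[OF measurable_restrict_subset a]
            measurable_compose[OF measurable_restrict_subset g]) auto
    have e: "restrict (restrict s ?W) ?V = restrict s ?V"
      "restrict (restrict s ?W) (C \<inter> ?V) = restrict s (C \<inter> ?V)" for s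
      by (auto simp: fun_eq_iff)
    show "(\<integral>\<^sup>+ s. a (restrict s ?V) * h (restrict s C) \<partial>kernel_product G ((u # Ls) @ Vs)) =
      (\<integral>\<^sup>+ s. a (restrict s ?V) * g (restrict s (C \<inter> ?V)) \<partial>kernel_product G ((u # Ls) @ Vs))"
      using nn_integral_kernel_product_Cons_indep[OF _ _ m, of u] Cons.prems(1,2) step[OF a] IH[OF a]
      unfolding e by simp
  qed
qed

section \<open>Sampling a parent-closed set first\<close>

text \<open>Inserting \<open>X\<close> only enlarges the tail behind each entry of
  \<open>Ls\<close>, so the parents of those entries are still found there.\<close>

lemma sampling_order_insert:
  assumes "sampling_order G (Ls @ Vs)" "X \<notin> set (Ls @ Vs)" "parents G X \<subseteq> set Vs"
  shows "sampling_order G (Ls @ X # Vs)"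
  using assms by (induction Ls) auto

text \<open>Variables in \<open>V\<close> have all their parents in \<open>V\<close>, so
  \<open>V\<close> can be moved to the end of the list, where sampling starts, without separating
  any of them from its parents.\<close>

lemma sampling_order_partition:
  assumes "sampling_order G Xs" "\<And>X. X \<in> V \<Longrightarrow> parents G X \<subseteq> V"
  shows "sampling_order G (filter (\<lambda>X. X \<notin> V) Xs @ filter (\<lambda>X. X \<in> V) Xs)"
  using assms(1)
proof (induction Xs)
  case (Cons X Xs)
  show ?case
  proof (cases "X \<in> V")
    case True
    then show ?thesis using Cons assms(2)[OF True] by (auto intro!: sampling_order_insert)
  qed (use Cons in auto)
qed simp


section \<open>The frontier as a cut between a set of variables and the cost\<close>

lemma directed_path_Cons:
  assumes "(u, v) \<in> E" "directed_path E v p w"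
  shows "directed_path E u (u # p) w"
  using assms by (cases p) (auto simp: directed_path_def)

lemma frontier_subset: "frontier G V \<subseteq> V"
  by (auto simp: frontier_def)

text \<open>
  \<open>C\<close> consists of the frontier and of those variables outside \<open>V\<close> that reach the cost without
  meeting \<open>V\<close>.
\<close>
lemma frontier_cut:
  assumes scg: "stochastic_computation_graph G"
  obtains C where "cost_vars G \<subseteq> C" "C \<subseteq> vars G \<union> V" "C \<inter> V = frontier G V"
    "\<And>u. u \<in> C \<Longrightarrow> u \<notin> V \<Longrightarrow> parents G u \<subseteq> C"
proof -
  \<comment> \<open>In contrast to \<open>frontier\<close>, the start node must lie outside
    \<open>V\<close> as well: \<open>butlast p\<close> still contains it.\<close>
  let ?avoids = "\<lambda>u p. directed_path (ext_edges G) (Some u) p None \<and>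
    set (butlast p) \<subseteq> Some ` (vars G - V)"
  define U where "U = {u \<in> vars G - V. \<exists>p. ?avoids u p}"
  have E: "edges G \<subseteq> vars G \<times> vars G" and Z: "cost_vars G \<subseteq> vars G"
    using scg by (auto simp: stochastic_computation_graph_def)
  show thesis
  proof (rule that[of "frontier G V \<union> U"])
    show "cost_vars G \<subseteq> frontier G V \<union> U"
    proof
      fix z assume z: "z \<in> cost_vars G"
      then have p: "directed_path (ext_edges G) (Some z) [Some z, None] None"
        by (auto simp: directed_path_def ext_edges_def)
      show "z \<in> frontier G V \<union> U"
      proof (cases "z \<in> V")
        case True
        then show ?thesis using p by (auto simp: frontier_def intro!: exI[of _ "[Some z, None]"])
      next
        case False
        then show ?thesis using p z Z by (auto simp: U_def intro!: exI[of _ "[Some z, None]"])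
      qed
    qed
    show "parents G u \<subseteq> frontier G V \<union> U" if "u \<in> frontier G V \<union> U" "u \<notin> V" for u
    proof
      fix w assume w: "w \<in> parents G u"
      have "u \<in> U" using that frontier_subset[of G V] by auto
      then obtain p where p: "?avoids u p" by (auto simp: U_def)
      \<comment> \<open>Prepend \<open>w\<close> to the path of \<open>u\<close>, all of whose
        variables lie outside \<open>V\<close>. If \<open>w\<close> is in \<open>V\<close>, the new
        path witnesses membership in the frontier; otherwise it avoids \<open>V\<close> too.\<close>
      have "(Some w, Some u) \<in> ext_edges G" using w by (auto simp: ext_edges_def parents_def)
      then have wp: "directed_path (ext_edges G) (Some w) (Some w # p) None"
        using p by (auto intro: directed_path_Cons)
      show "w \<in> frontier G V \<union> U"
      proof (cases "w \<in> V")
        case True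
        then have "w \<in> frontier G V"
          unfolding frontier_def using wp p by (intro CollectI conjI exI[of _ "Some w # p"]) auto
        then show ?thesis by simp
      next
        case False
        moreover have "w \<in> vars G" using w E by (auto simp: parents_def)
        ultimately have "w \<in> U"
          unfolding U_def using wp p
          by (intro CollectI conjI exI[of _ "Some w # p"]) (auto split: if_splits)
        then show ?thesis by simp
      qed
    qed
  qed (auto simp: U_def frontier_def)
qed

section \<open>The joint distribution and the sigma-algebras generated by sets of variables\<close>

lemma prob_space_joint_distribution:
  assumes "stochastic_computation_graph G"
  shows "prob_space (joint_distribution G)"
    and "sets (joint_distribution G) = sets (Pi\<^sub>M (vars G) (vspace G))"
proof -
  obtain Xs where Xs: "set Xs = vars G" "sampling_order G Xs"
    using sampling_order_exists[of "vars G" G] assms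
    by (auto simp: stochastic_computation_graph_def parents_def)
  have "kernel_product G Xs \<in> space (prob_algebra (Pi\<^sub>M (set Xs) (vspace G)))"
    using Xs assms
    by (intro kernel_product_in_space) (auto simp: stochastic_computation_graph_def is_kernel_def)
  then show "prob_space (joint_distribution G)"
    and "sets (joint_distribution G) = sets (Pi\<^sub>M (vars G) (vspace G))"
    using joint_distribution_eq[OF assms Xs] Xs(1) by (auto simp: space_prob_algebra)
qed

lemma measurable_restrict_joint_distribution:
  assumes "stochastic_computation_graph G" "V \<subseteq> vars G"
  shows "(\<lambda>s. restrict s V) \<in> joint_distribution G \<rightarrow>\<^sub>M Pi\<^sub>M V (vspace G)"
  using measurable_restrict_subset[OF assms(2)] prob_space_joint_distribution(2)[OF assms(1)]
  by (simp cong: measurable_cong_sets)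

lemma space_sigma_of [simp]: "space (sigma_of G V) = space (joint_distribution G)"
  by (simp add: sigma_of_def)

text \<open>Restriction to \<open>W\<close> factors through restriction to \<open>V\<close>, which
  generates \<open>sigma_of G V\<close>.\<close>

lemma measurable_sigma_of:
  assumes "stochastic_computation_graph G" "W \<subseteq> V" "V \<subseteq> vars G"
  shows "(\<lambda>s. restrict s W) \<in> sigma_of G V \<rightarrow>\<^sub>M Pi\<^sub>M W (vspace G)"
proof -
  have "(\<lambda>s. restrict s V) \<in> sigma_of G V \<rightarrow>\<^sub>M Pi\<^sub>M V (vspace G)"
    unfolding sigma_of_def
    using measurable_space[OF measurable_restrict_joint_distribution[OF assms(1,3)]]
    by (intro measurable_vimage_algebra1) auto
  from measurable_compose[OF this measurable_restrict_subset[OF assms(2)]]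
  show ?thesis using assms(2) by (simp add: Int_absorb1)
qed

lemma subalgebra_sigma_of:
  assumes "stochastic_computation_graph G" "V \<subseteq> vars G"
  shows "subalgebra (joint_distribution G) (sigma_of G V)"
  unfolding subalgebra_def sigma_of_def
  using sets_image_in_sets[OF refl measurable_restrict_joint_distribution[OF assms]] by simp

lemma subalgebra_sigma_of_mono:
  assumes "stochastic_computation_graph G" "W \<subseteq> V" "V \<subseteq> vars G"
  shows "subalgebra (sigma_of G V) (sigma_of G W)"
proof -
  have "sets (sigma_of G W) \<subseteq> sets (sigma_of G V)"
    unfolding sigma_of_def[of G W]
    using measurable_sigma_of[OF assms] by (intro sets_image_in_sets) auto
  then show ?thesis by (simp add: subalgebra_def)
qed

lemma sigma_finite_sigma_of:
  assumes "stochastic_computation_graph G" "V \<subseteq> vars G"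
  shows "sigma_finite_subalgebra (joint_distribution G) (sigma_of G V)"
proof -
  interpret prob_space "joint_distribution G"
    by (rule prob_space_joint_distribution[OF assms(1)])
  show ?thesis
    by (intro finite_measure_subalgebra_is_sigma_finite finite_measure_subalgebra.intro
        finite_measure_subalgebra_axioms.intro subalgebra_sigma_of assms) unfold_locales
qed

section \<open>Conditional expectations of the cost, and Jensen's inequality\<close>

text \<open>With \<open>V\<close> sampled first, integrating out the other variables along the cut
  \<open>C\<close> leaves a function \<open>g\<close> of the frontier. It is measurable for the
  smaller sigma-algebra and has the right integrals over sets of the larger one, hence is a version
  of both conditional expectations.\<close>

lemma nn_cond_exp_frontier:
  fixes h :: "('v \<Rightarrow> 'a) \<Rightarrow> ennreal" and G :: "('v, 'a) scg"
  assumes scg: "stochastic_computation_graph G" and V: "V \<subseteq> vars G"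
    and closed: "\<And>X. X \<in> V \<Longrightarrow> parents G X \<subseteq> V"
    and h: "h \<in> borel_measurable (Pi\<^sub>M (cost_vars G) (vspace G))"
  defines "M \<equiv> joint_distribution G" and "f \<equiv> \<lambda>s. h (restrict s (cost_vars G))"
  shows "AE s in M. nn_cond_exp M (sigma_of G V) f s = nn_cond_exp M (sigma_of G (frontier G V)) f s"
proof -
  obtain C where C: "cost_vars G \<subseteq> C" "C \<subseteq> vars G \<union> V" "C \<inter> V = frontier G V"
    "\<And>u. u \<in> C \<Longrightarrow> u \<notin> V \<Longrightarrow> parents G u \<subseteq> C"
    using frontier_cut[OF scg] by blast
  obtain Xs where Xs: "set Xs = vars G" "sampling_order G Xs"
    using sampling_order_exists[of "vars G" G] scg
    by (auto simp: stochastic_computation_graph_def parents_def)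
  define Ls Vs where "Ls = filter (\<lambda>X. X \<notin> V) Xs" and "Vs = filter (\<lambda>X. X \<in> V) Xs"
  have so: "sampling_order G (Ls @ Vs)"
    unfolding Ls_def Vs_def using Xs(2) closed by (rule sampling_order_partition)
  have sets: "set (Ls @ Vs) = vars G" "set Vs = V" "set Ls = vars G - V"
    using Xs(1) V by (auto simp: Ls_def Vs_def)
  have M: "kernel_product G (Ls @ Vs) = M"
    unfolding M_def using joint_distribution_eq[OF scg sets(1) so] by simp
  have CZ: "restrict (restrict s C) (cost_vars G) = restrict s (cost_vars G)" for s
    using C(1) by (auto simp: fun_eq_iff)
  have "\<exists>g \<in> borel_measurable (Pi\<^sub>M (C \<inter> set Vs) (vspace G)).
    \<forall>a \<in> borel_measurable (Pi\<^sub>M (set Vs) (vspace G)).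
      (\<integral>\<^sup>+ s. a (restrict s (set Vs)) * f (restrict s C) \<partial>kernel_product G (Ls @ Vs)) =
      (\<integral>\<^sup>+ s. a (restrict s (set Vs)) * g (restrict s (C \<inter> set Vs)) \<partial>kernel_product G (Ls @ Vs))"
  proof (rule kernel_product_conditional[OF _ so])
    show "is_kernel G Y" if "Y \<in> set (Ls @ Vs)" for Y
      using that scg unfolding sets by (simp add: stochastic_computation_graph_def is_kernel_def)
    show "C \<subseteq> set (Ls @ Vs)" using C(2) V unfolding sets by auto
    show "parents G u \<subseteq> C" if "u \<in> C" "u \<in> set Ls" for u
      using that C(4) unfolding sets by auto
    show "f \<in> borel_measurable (Pi\<^sub>M C (vspace G))"
      unfolding f_def by (rule measurable_compose[OF measurable_restrict_subset[OF C(1)] h])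
  qed
  then obtain g where g: "g \<in> borel_measurable (Pi\<^sub>M (frontier G V) (vspace G))"
    and eq: "\<And>a. a \<in> borel_measurable (Pi\<^sub>M V (vspace G)) \<Longrightarrow>
      (\<integral>\<^sup>+ s. a (restrict s V) * f s \<partial>M) =
      (\<integral>\<^sup>+ s. a (restrict s V) * g (restrict s (frontier G V)) \<partial>M)"
    unfolding sets M C(3) f_def CZ by blast
  have fM: "f \<in> borel_measurable M"
    unfolding f_def M_def using scg
    by (intro measurable_compose[OF measurable_restrict_joint_distribution h])
      (auto simp: stochastic_computation_graph_def)
  \<comment> \<open>Stated for every \<open>W\<close> between the frontier and \<open>V\<close>,
    since both extremes are used.\<close>
  have ce: "AE s in M. g (restrict s (frontier G V)) = nn_cond_exp M (sigma_of G W) f s"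
    if W: "frontier G V \<subseteq> W" "W \<subseteq> V" for W
  proof -
    have WX: "W \<subseteq> vars G" using W V by auto
    interpret sigma_finite_subalgebra M "sigma_of G W"
      unfolding M_def by (rule sigma_finite_sigma_of[OF scg WX])
    show ?thesis
    proof (rule nn_cond_exp_charact[OF _ fM])
      show "(\<lambda>s. g (restrict s (frontier G V))) \<in> borel_measurable (sigma_of G W)"
        by (rule measurable_compose[OF measurable_sigma_of[OF scg W(1) WX] g])
      \<comment> \<open>\<open>A\<close> also belongs to the sigma-algebra of \<open>V\<close>, so
        it is the preimage of some \<open>B\<close>, whose indicator is the test function put into
        \<open>eq\<close>.\<close>
      fix A assume "A \<in> sets (sigma_of G W)"
      then have "A \<in> sets (sigma_of G V)"
        using subalgebra_sigma_of_mono[OF scg W(2) V] by (auto simp: subalgebra_def)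
      moreover have "(\<lambda>s. restrict s V) \<in> space M \<rightarrow> space (Pi\<^sub>M V (vspace G))"
        unfolding M_def using measurable_space[OF measurable_restrict_joint_distribution[OF scg V]] by auto
      ultimately obtain B where B: "B \<in> sets (Pi\<^sub>M V (vspace G))"
        "A = (\<lambda>s. restrict s V) -` B \<inter> space M"
        unfolding sigma_of_def by (auto simp: sets_vimage_algebra2 M_def)
      have ind: "indicator A s = (indicator B (restrict s V) :: ennreal)" if "s \<in> space M" for s
        using that B(2) by (auto simp: indicator_def)
      have "(\<integral>\<^sup>+ s. f s * indicator A s \<partial>M) = (\<integral>\<^sup>+ s. indicator B (restrict s V) * f s \<partial>M)"
        by (intro nn_integral_cong) (simp add: ind mult.commute)
      also have "\<dots> = (\<integral>\<^sup>+ s. indicator B (restrict s V) * g (restrict s (frontier G V)) \<partial>M)"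
        using B(1) by (intro eq) simp
      also have "\<dots> = (\<integral>\<^sup>+ s. g (restrict s (frontier G V)) * indicator A s \<partial>M)"
        by (intro nn_integral_cong) (simp add: ind mult.commute)
      finally show "(\<integral>\<^sup>+ s\<in>A. f s \<partial>M) = (\<integral>\<^sup>+ s\<in>A. g (restrict s (frontier G V)) \<partial>M)" .
    qed
  qed
  show ?thesis
    using ce[of V] ce[of "frontier G V"] frontier_subset[of G V] by (auto elim: AE_mp)
qed

text \<open>\<open>real_cond_exp\<close> is the difference of the conditional expectations of the
  positive and negative parts; \<open>ennreal\<close> truncates at zero, so these parts are
  \<open>ennreal (f s)\<close> and \<open>ennreal (- f s)\<close>.\<close>

lemma real_cond_exp_frontier:
  fixes G :: "('v, 'a) scg"
  assumes scg: "stochastic_computation_graph G" and V: "V \<subseteq> vars G"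
    and closed: "\<And>X. X \<in> V \<Longrightarrow> parents G X \<subseteq> V"
  defines "M \<equiv> joint_distribution G" and "f \<equiv> \<lambda>s. cost G (restrict s (cost_vars G))"
  shows "AE s in M.
    real_cond_exp M (sigma_of G V) f s = real_cond_exp M (sigma_of G (frontier G V)) f s"
proof -
  have c: "cost G \<in> borel_measurable (Pi\<^sub>M (cost_vars G) (vspace G))"
    using scg by (simp add: stochastic_computation_graph_def)
  have "AE s in M. nn_cond_exp M (sigma_of G V) (\<lambda>s. ennreal (f s)) s =
      nn_cond_exp M (sigma_of G (frontier G V)) (\<lambda>s. ennreal (f s)) s"
    unfolding M_def f_def using c
    by (intro nn_cond_exp_frontier[OF scg V closed, where h="\<lambda>r. ennreal (cost G r)"]) auto
  moreover have "AE s in M. nn_cond_exp M (sigma_of G V) (\<lambda>s. ennreal (- f s)) s =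
      nn_cond_exp M (sigma_of G (frontier G V)) (\<lambda>s. ennreal (- f s)) s"
    unfolding M_def f_def using c
    by (intro nn_cond_exp_frontier[OF scg V closed, where h="\<lambda>r. ennreal (- cost G r)"]) auto
  ultimately show ?thesis
    by eventually_elim (simp add: real_cond_exp_def)
qed

text \<open>Conditional expectation is a contraction in mean square: conditional Jensen for the
  square, then integrate, as conditioning preserves integrals.\<close>

lemma (in sigma_finite_subalgebra) real_cond_exp_square_le:
  fixes D :: "'a \<Rightarrow> real"
  assumes "integrable M D" "integrable M (\<lambda>x. (D x)\<^sup>2)"
  shows "integrable M (\<lambda>x. (real_cond_exp M F D x)\<^sup>2)"
    and "(\<integral>x. (real_cond_exp M F D x)\<^sup>2 \<partial>M) \<le> (\<integral>x. (D x)\<^sup>2 \<partial>M)"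
proof -
  have J: "AE x in M. (real_cond_exp M F D x)\<^sup>2 \<le> real_cond_exp M F (\<lambda>x. (D x)\<^sup>2) x"
    by (rule real_cond_exp_jensens_inequality(2)[where I=UNIV and q="\<lambda>x. x\<^sup>2"])
      (use assms convex_power2 in auto)
  have I: "integrable M (real_cond_exp M F (\<lambda>x. (D x)\<^sup>2))"
    using assms by (intro real_cond_exp_int)
  show sq: "integrable M (\<lambda>x. (real_cond_exp M F D x)\<^sup>2)"
    by (rule Bochner_Integration.integrable_bound[OF I]) (use J in auto)
  have "(\<integral>x. (real_cond_exp M F D x)\<^sup>2 \<partial>M) \<le> (\<integral>x. real_cond_exp M F (\<lambda>x. (D x)\<^sup>2) x \<partial>M)"
    by (rule integral_mono_AE[OF sq I J])
  then show "(\<integral>x. (real_cond_exp M F D x)\<^sup>2 \<partial>M) \<le> (\<integral>x. (D x)\<^sup>2 \<partial>M)"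
    using real_cond_exp_int(2)[OF assms(2)] by simp
qed

section \<open>Ancestor sets of network nodes\<close>

lemma ancestors_subset_vars:
  assumes "stochastic_computation_graph G"
  shows "ancestors G n \<subseteq> vars G"
proof
  fix Y assume "Y \<in> ancestors G n"
  then have "(Some Y, n) \<in> (ext_edges G)\<^sup>+" by (simp add: ancestors_def)
  then obtain m where "(Some Y, m) \<in> ext_edges G" by (meson tranclD)
  then show "Y \<in> vars G"
    using assms by (auto simp: ext_edges_def stochastic_computation_graph_def)
qed

lemma bq_node_in_vars:
  assumes "stochastic_computation_graph G" "Some X \<in> bq_nodes G"
  shows "X \<in> vars G"
proof -
  have "(Some X, None) \<in> (ext_edges G)\<^sup>*"
    using assms(2) by (simp add: bq_nodes_def rtrancl_converse)
  then have "X \<in> ancestors G None"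
    by (auto simp: ancestors_def dest: rtranclD)
  then show ?thesis using ancestors_subset_vars[OF assms(1)] by auto
qed

lemma closed_ancestors_subset_vars:
  assumes "stochastic_computation_graph G" "n \<in> bq_nodes G"
  shows "closed_ancestors G n \<subseteq> vars G"
  using ancestors_subset_vars[OF assms(1), of n] bq_node_in_vars[OF assms(1)] assms(2)
  by (auto simp: closed_ancestors_def)

text \<open>This closure allows the closed ancestors to be sampled before all other
  variables.\<close>

lemma parents_closed_ancestors:
  assumes "X \<in> closed_ancestors G n"
  shows "parents G X \<subseteq> closed_ancestors G n"
proof -
  have e: "(Some Y, Some X) \<in> ext_edges G" if "Y \<in> parents G X" for Y
    using that by (auto simp: ext_edges_def parents_def)
  then show ?thesis
    using assms by (auto simp: closed_ancestors_def ancestors_def intro: trancl_into_trancl2)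
qed

lemma scope_subset_closed_ancestors: "scope G n \<subseteq> closed_ancestors G n"
proof (cases n)
  case None
  then show ?thesis by (auto simp: closed_ancestors_def ancestors_def ext_edges_def)
qed (simp add: frontier_subset)

text \<open>Makes the sigma-algebras grow along edges towards the cost, as the tower property
  requires.\<close>

lemma closed_ancestors_mono:
  assumes "(Some X, n) \<in> ext_edges G"
  shows "closed_ancestors G (Some X) \<subseteq> closed_ancestors G n"
  using assms by (auto simp: closed_ancestors_def ancestors_def intro: trancl_into_trancl)


section \<open>True Q-functions as conditional expectations\<close>

lemma true_Q_measurable:
  assumes "stochastic_computation_graph G" "true_Q G n q"
  shows "q \<in> borel_measurable (Pi\<^sub>M (scope G n) (vspace G))"
  using assms by (cases n) (auto simp: stochastic_computation_graph_def)

text \<open>The scope of a variable is the frontier of its closed ancestors, so both give the same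
  conditional expectation; at the root the cost is already measurable. Scopes need not be nested
  along edges, whereas closed ancestors are.\<close>

lemma true_Q_cond_exp:
  fixes G :: "('v, 'a) scg"
  defines "M \<equiv> joint_distribution G" and "f \<equiv> \<lambda>s. cost G (restrict s (cost_vars G))"
  assumes scg: "stochastic_computation_graph G" and f: "integrable M f"
    and n: "n \<in> bq_nodes G" and Q: "true_Q G n q"
  shows "AE s in M. q (restrict s (scope G n)) = real_cond_exp M (sigma_of G (closed_ancestors G n)) f s"
proof -
  note V = closed_ancestors_subset_vars[OF scg n]
  show ?thesis
  proof (cases n)
    case None
    interpret sigma_finite_subalgebra M "sigma_of G (closed_ancestors G n)"
      unfolding M_def by (rule sigma_finite_sigma_of[OF scg V])
    have "f \<in> borel_measurable (sigma_of G (closed_ancestors G n))"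
      unfolding f_def
      using measurable_sigma_of[OF scg scope_subset_closed_ancestors V] true_Q_measurable[OF scg Q] Q None
      by (auto intro: measurable_compose)
    then have "AE s in M. real_cond_exp M (sigma_of G (closed_ancestors G n)) f s = f s"
      using f by (intro real_cond_exp_F_meas)
    then show ?thesis using Q None by (simp add: f_def eq_commute)
  next
    case (Some X)
    then have "AE s in M. q (restrict s (scope G n)) = real_cond_exp M (sigma_of G (scope G n)) f s"
      using Q unfolding M_def f_def by simp
    moreover have "AE s in M. real_cond_exp M (sigma_of G (closed_ancestors G n)) f s =
        real_cond_exp M (sigma_of G (scope G n)) f s"
      using real_cond_exp_frontier[OF scg V parents_closed_ancestors] Some unfolding M_def f_def by simp
    ultimately show ?thesis by eventually_elim simp
  qed
qed

text \<open>
  Conditioning \<open>w - q\<^sub>n\<close> on the ancestors of \<open>X\<close> turns \<open>q\<^sub>n\<close> into \<open>q\<^sub>X\<close>, by the tower property,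
  and does not change \<open>w\<close>.
\<close>
lemma true_Q_error_le:
  fixes G :: "('v, 'a) scg"
  defines "M \<equiv> joint_distribution G"
  assumes scg: "stochastic_computation_graph G"
    and f: "integrable M (\<lambda>s. cost G (restrict s (cost_vars G)))"
    and edge: "(n, Some X) \<in> bq_edges G"
    and Qn: "true_Q G n qn" and QX: "true_Q G (Some X) qX"
    and w: "w \<in> borel_measurable (Pi\<^sub>M (scope G (Some X)) (vspace G))"
    and sq: "integrable M (\<lambda>s. (w (restrict s (scope G (Some X))) - qn (restrict s (scope G n)))\<^sup>2)"
  shows "integrable M (\<lambda>s. (w (restrict s (scope G (Some X))) - qX (restrict s (scope G (Some X))))\<^sup>2)"
    and "(\<integral>s. (w (restrict s (scope G (Some X))) - qX (restrict s (scope G (Some X))))\<^sup>2 \<partial>M)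
      \<le> (\<integral>s. (w (restrict s (scope G (Some X))) - qn (restrict s (scope G n)))\<^sup>2 \<partial>M)"
proof -
  define W QN QY where "W s = w (restrict s (scope G (Some X)))"
    and "QN s = qn (restrict s (scope G n))" and "QY s = qX (restrict s (scope G (Some X)))" for s
  let ?f = "\<lambda>s. cost G (restrict s (cost_vars G))"
  let ?V = "closed_ancestors G (Some X)" and ?V' = "closed_ancestors G n"
  have n: "n \<in> bq_nodes G" and X: "Some X \<in> bq_nodes G" and e: "(Some X, n) \<in> ext_edges G"
    using edge by (auto simp: bq_edges_def)
  note V = closed_ancestors_subset_vars[OF scg X] and V' = closed_ancestors_subset_vars[OF scg n]
  interpret prob_space M unfolding M_def by (rule prob_space_joint_distribution[OF scg])
  interpret A: sigma_finite_subalgebra M "sigma_of G ?V"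
    unfolding M_def by (rule sigma_finite_sigma_of[OF scg V])
  interpret B: sigma_finite_subalgebra M "sigma_of G ?V'"
    unfolding M_def by (rule sigma_finite_sigma_of[OF scg V'])
  have WA: "W \<in> borel_measurable (sigma_of G ?V)"
    unfolding W_def by (rule measurable_compose[OF measurable_sigma_of[OF scg scope_subset_closed_ancestors V] w])
  then have WM[measurable]: "W \<in> borel_measurable M"
    by (rule measurable_from_subalg[OF A.subalg])
  have QNM[measurable]: "QN \<in> borel_measurable M"
    unfolding QN_def
    by (rule measurable_from_subalg[OF B.subalg
          measurable_compose[OF measurable_sigma_of[OF scg scope_subset_closed_ancestors V']
            true_Q_measurable[OF scg Qn]]])
  have QYM[measurable]: "QY \<in> borel_measurable M"
    unfolding QY_def
    by (rule measurable_from_subalg[OF A.subalg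
          measurable_compose[OF measurable_sigma_of[OF scg scope_subset_closed_ancestors V]
            true_Q_measurable[OF scg QX]]])
  have QN: "AE s in M. QN s = real_cond_exp M (sigma_of G ?V') ?f s"
    using true_Q_cond_exp[OF scg _ n Qn] f unfolding M_def QN_def by simp
  have QY: "AE s in M. QY s = real_cond_exp M (sigma_of G ?V) ?f s"
    using true_Q_cond_exp[OF scg _ X QX] f unfolding M_def QY_def by simp
  have QN_int: "integrable M QN"
    using QN B.real_cond_exp_int(1)[OF f] by (subst integrable_cong_AE[OF _ _ QN]) auto
  have sq': "integrable M (\<lambda>s. (W s - QN s)\<^sup>2)"
    using sq by (simp add: W_def QN_def)
  \<comment> \<open>On a probability space, square integrability implies integrability. Adding
    \<open>QN\<close> back then shows that \<open>W\<close> is integrable.\<close>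
  then have D_int: "integrable M (\<lambda>s. W s - QN s)"
    by (rule square_integrable_imp_integrable[rotated]) measurable
  have W_int: "integrable M W"
    using Bochner_Integration.integrable_add[OF D_int QN_int] by simp
  have "AE s in M. real_cond_exp M (sigma_of G ?V) QN s =
      real_cond_exp M (sigma_of G ?V) (real_cond_exp M (sigma_of G ?V') ?f) s"
    using QN by (rule A.real_cond_exp_cong) auto
  moreover have "AE s in M. real_cond_exp M (sigma_of G ?V) (real_cond_exp M (sigma_of G ?V') ?f) s =
      real_cond_exp M (sigma_of G ?V) ?f s"
    by (rule A.real_cond_exp_nested_subalg[OF B.subalg
          subalgebra_sigma_of_mono[OF scg closed_ancestors_mono[OF e] V'] f])
  moreover have "AE s in M. real_cond_exp M (sigma_of G ?V) (\<lambda>s. W s - QN s) s =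
      real_cond_exp M (sigma_of G ?V) W s - real_cond_exp M (sigma_of G ?V) QN s"
    using W_int QN_int by (rule A.real_cond_exp_diff)
  moreover have "AE s in M. real_cond_exp M (sigma_of G ?V) W s = W s"
    using W_int WA by (rule A.real_cond_exp_F_meas)
  ultimately have "AE s in M. W s - QY s = real_cond_exp M (sigma_of G ?V) (\<lambda>s. W s - QN s) s"
    using QY by eventually_elim simp
  then have eq: "AE s in M. (W s - QY s)\<^sup>2 = (real_cond_exp M (sigma_of G ?V) (\<lambda>s. W s - QN s) s)\<^sup>2"
    by eventually_elim simp
  have "integrable M (\<lambda>s. (W s - QY s)\<^sup>2)"
    using A.real_cond_exp_square_le(1)[OF D_int sq'] by (subst integrable_cong_AE[OF _ _ eq]) auto
  then show "integrable M (\<lambda>s. (w (restrict s (scope G (Some X))) - qX (restrict s (scope G (Some X))))\<^sup>2)"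
    by (simp add: W_def QY_def)
  have "(\<integral>s. (W s - QY s)\<^sup>2 \<partial>M) \<le> (\<integral>s. (W s - QN s)\<^sup>2 \<partial>M)"
    using A.real_cond_exp_square_le(2)[OF D_int sq'] by (subst integral_cong_AE[OF _ _ eq]) auto
  then show "(\<integral>s. (w (restrict s (scope G (Some X))) - qX (restrict s (scope G (Some X))))\<^sup>2 \<partial>M)
      \<le> (\<integral>s. (w (restrict s (scope G (Some X))) - qn (restrict s (scope G n)))\<^sup>2 \<partial>M)"
    by (simp add: W_def QY_def QN_def)
qed

section \<open>The error recursion along a path to the root\<close>

text \<open>The squared difference reads only the two scopes, so restriction to \<open>V\<close>
  does not change it. All errors can thus be compared under the joint distribution.\<close>

lemma marginal_sq_diff:
  assumes scg: "stochastic_computation_graph G" and V: "V \<subseteq> vars G"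
    and m: "scope G m \<subseteq> V" "q m \<in> borel_measurable (Pi\<^sub>M (scope G m) (vspace G))"
    and n: "scope G n \<subseteq> V" "q' n \<in> borel_measurable (Pi\<^sub>M (scope G n) (vspace G))"
  shows "integrable (marginal G V) (sq_diff G q m q' n) \<longleftrightarrow>
      integrable (joint_distribution G) (sq_diff G q m q' n)"
    and "integral\<^sup>L (marginal G V) (sq_diff G q m q' n) =
      integral\<^sup>L (joint_distribution G) (sq_diff G q m q' n)"
proof -
  have sq: "sq_diff G q m q' n \<in> borel_measurable (Pi\<^sub>M V (vspace G))"
    unfolding sq_diff_def[abs_def]
    by (intro borel_measurable_power borel_measurable_diff
          measurable_compose[OF measurable_restrict_subset[OF m(1)] m(2)]
          measurable_compose[OF measurable_restrict_subset[OF n(1)] n(2)])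
  have "sq_diff G q m q' n (restrict s V) = sq_diff G q m q' n s" for s
    using m(1) n(1) by (simp add: sq_diff_def Int_absorb1)
  then show "integrable (marginal G V) (sq_diff G q m q' n) \<longleftrightarrow>
      integrable (joint_distribution G) (sq_diff G q m q' n)"
    and "integral\<^sup>L (marginal G V) (sq_diff G q m q' n) =
      integral\<^sup>L (joint_distribution G) (sq_diff G q m q' n)"
    unfolding marginal_def
    using measurable_restrict_joint_distribution[OF scg V] sq
    by (simp_all add: integrable_distr_eq integral_distr)
qed

text \<open>The inequality follows from the nonnegativity of the square of \<open>a x - b x\<close>;
  it is the source of the doubling in the recursion.\<close>

lemma integrable_square_add:
  fixes a b :: "'a \<Rightarrow> real"
  assumes [measurable]: "a \<in> borel_measurable M" "b \<in> borel_measurable M"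
    and a: "integrable M (\<lambda>x. (a x)\<^sup>2)" and b: "integrable M (\<lambda>x. (b x)\<^sup>2)"
  shows "integrable M (\<lambda>x. (a x + b x)\<^sup>2)"
    and "(\<integral>x. (a x + b x)\<^sup>2 \<partial>M) \<le> 2 * (\<integral>x. (a x)\<^sup>2 \<partial>M) + 2 * (\<integral>x. (b x)\<^sup>2 \<partial>M)"
proof -
  have le: "(a x + b x)\<^sup>2 \<le> 2 * (a x)\<^sup>2 + 2 * (b x)\<^sup>2" for x
    using zero_le_power2[of "a x - b x"] by (simp add: power2_sum power2_diff)
  have I: "integrable M (\<lambda>x. 2 * (a x)\<^sup>2 + 2 * (b x)\<^sup>2)"
    using a b by simp
  show sq: "integrable M (\<lambda>x. (a x + b x)\<^sup>2)"
    by (rule Bochner_Integration.integrable_bound[OF I]) (use le in auto)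
  have "(\<integral>x. (a x + b x)\<^sup>2 \<partial>M) \<le> (\<integral>x. 2 * (a x)\<^sup>2 + 2 * (b x)\<^sup>2 \<partial>M)"
    by (rule integral_mono[OF sq I le])
  then show "(\<integral>x. (a x + b x)\<^sup>2 \<partial>M) \<le> 2 * (\<integral>x. (a x)\<^sup>2 \<partial>M) + 2 * (\<integral>x. (b x)\<^sup>2 \<partial>M)"
    using a b by simp
qed

theorem theorem2:
  fixes G :: "('v, 'a) scg"
    and Q Qw :: "'v option \<Rightarrow> ('v \<Rightarrow> 'a) \<Rightarrow> real"
    and \<epsilon> :: real
  assumes scg: "stochastic_computation_graph G"
    and cost_integrable:
      "integrable (joint_distribution G) (\<lambda>s. cost G (restrict s (cost_vars G)))"
    and true_Q: "\<And>n. n \<in> bq_nodes G \<Longrightarrow> true_Q G n (Q n)"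
    and learned_root: "Qw None = cost G"
    and learned_measurable:
      "\<And>X. Some X \<in> bq_nodes G \<Longrightarrow>
         Qw (Some X) \<in> borel_measurable (Pi\<^sub>M (scope G (Some X)) (vspace G))"
    and eps: "\<epsilon> > 0"
    and edge_error:
      "\<And>X n. (n, Some X) \<in> bq_edges G \<Longrightarrow>
         integrable (marginal G (closed_ancestors G n)) (sq_diff G Qw (Some X) Qw n) \<and>
         integral\<^sup>L (marginal G (closed_ancestors G n)) (sq_diff G Qw (Some X) Qw n) \<le> \<epsilon>"
  shows "\<forall>n p. n \<in> bq_nodes G \<and> directed_path ((bq_edges G)\<inverse>) n p None \<and> path_length p \<ge> 1 \<longrightarrow>
           integrable (marginal G (closed_ancestors G n)) (sq_diff G Qw n Q n) \<and>
           integral\<^sup>L (marginal G (closed_ancestors G n)) (sq_diff G Qw n Q n)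
             \<le> (3 * 2 ^ (path_length p - 1) - 2) * \<epsilon>"
proof -
  let ?M = "joint_distribution G"
  have Qw: "Qw n \<in> borel_measurable (Pi\<^sub>M (scope G n) (vspace G))" if "n \<in> bq_nodes G" for n
    using that learned_root learned_measurable scg
    by (cases n) (auto simp: stochastic_computation_graph_def)
  have Q: "Q n \<in> borel_measurable (Pi\<^sub>M (scope G n) (vspace G))" if "n \<in> bq_nodes G" for n
    by (rule true_Q_measurable[OF scg true_Q[OF that]])
  have comp: "(\<lambda>s. q (restrict s (scope G n))) \<in> borel_measurable ?M"
    if "n \<in> bq_nodes G" "q \<in> borel_measurable (Pi\<^sub>M (scope G n) (vspace G))" for n and q :: "_ \<Rightarrow> real"
    using scope_subset_closed_ancestors[of G n] closed_ancestors_subset_vars[OF scg that(1)]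
    by (intro measurable_compose[OF measurable_restrict_joint_distribution[OF scg] that(2)]) auto
  \<comment> \<open>The cost node has no outgoing edge, so a path with a further node cannot start
    there.\<close>
  have root: "n \<noteq> None" if "directed_path ((bq_edges G)\<inverse>) n (n # m # p) None" for n m p
    using that by (auto simp: directed_path_def bq_edges_def ext_edges_def)
  have error: "integrable ?M (sq_diff G Qw n Q n) \<and>
      integral\<^sup>L ?M (sq_diff G Qw n Q n) \<le> (3 * 2 ^ (path_length p - 1) - 2) * \<epsilon>"
    if "directed_path ((bq_edges G)\<inverse>) n p None" "path_length p \<ge> 1" for n p
    using that
  proof (induction p arbitrary: n)
    case Nil
    then show ?case by (simp add: path_length_def)
  next
    case (Cons a p)
    obtain m p' where p: "p = m # p'"
      using Cons.prems(2) by (cases p) (auto simp: path_length_def)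
    have [simp]: "a = n" and e: "(m, n) \<in> bq_edges G"
      and path: "directed_path ((bq_edges G)\<inverse>) m p None"
      using Cons.prems(1) by (auto simp: directed_path_def p split: if_splits)
    obtain X where n: "n = Some X" using root[of n m p'] Cons.prems(1) by (auto simp: p)
    have nodes: "n \<in> bq_nodes G" "m \<in> bq_nodes G" using e by (auto simp: bq_edges_def)
    \<comment> \<open>The edge error is taken over the closed ancestors of \<open>m\<close>; these
      contain both scopes, so it equals the error under the joint distribution.\<close>
    have sub: "scope G n \<subseteq> closed_ancestors G m"
      using scope_subset_closed_ancestors[of G n] closed_ancestors_mono[of X m G] e n
      by (auto simp: bq_edges_def)
    note marg = marginal_sq_diff[where q=Qw and q'=Qw, OF scg closed_ancestors_subset_vars[OF scg nodes(2)] sub Qw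
        scope_subset_closed_ancestors Qw, OF nodes]
    have edge: "integrable ?M (sq_diff G Qw n Qw m)" "integral\<^sup>L ?M (sq_diff G Qw n Qw m) \<le> \<epsilon>"
      using edge_error[of m X] e marg unfolding n by auto
    \<comment> \<open>The bound is first proved with \<open>Q m\<close> in place of
      \<open>Q n\<close>; exchanging them afterwards does not increase the error.\<close>
    have "integrable ?M (sq_diff G Qw n Q m) \<and>
        integral\<^sup>L ?M (sq_diff G Qw n Q m) \<le> (3 * 2 ^ (path_length (a # p) - 1) - 2) * \<epsilon>"
    proof (cases p')
      case Nil
      \<comment> \<open>For a path of length one the coefficient is
        \<open>3 * 2 ^ 0 - 2 = 1\<close>, and the edge error is already the claim.\<close>
      then have "m = None" using path by (simp add: p directed_path_def)
      then have "Q m = Qw m" using true_Q[OF nodes(2)] learned_root by simp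
      then have "sq_diff G Qw n Q m = sq_diff G Qw n Qw m" by (simp add: sq_diff_def fun_eq_iff)
      then show ?thesis using edge Nil p by (simp add: path_length_def)
    next
      case (Cons b p'')
      \<comment> \<open>\<open>Qw n - Q m\<close> splits into the edge difference \<open>?a\<close>
        and the error \<open>?b\<close> of \<open>m\<close>.\<close>
      let ?a = "\<lambda>s. Qw n (restrict s (scope G n)) - Qw m (restrict s (scope G m))"
      let ?b = "\<lambda>s. Qw m (restrict s (scope G m)) - Q m (restrict s (scope G m))"
      have IH: "integrable ?M (sq_diff G Qw m Q m)"
        "integral\<^sup>L ?M (sq_diff G Qw m Q m) \<le> (3 * 2 ^ (path_length p - 1) - 2) * \<epsilon>"
        using Cons.IH[OF path] Cons p by (auto simp: path_length_def)
      have "integrable ?M (\<lambda>s. (?a s + ?b s)\<^sup>2)"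
        "(\<integral>s. (?a s + ?b s)\<^sup>2 \<partial>?M) \<le> 2 * (\<integral>s. (?a s)\<^sup>2 \<partial>?M) + 2 * (\<integral>s. (?b s)\<^sup>2 \<partial>?M)"
        by (rule integrable_square_add; use edge(1) IH(1) nodes Qw Q comp in
            \<open>auto intro!: borel_measurable_diff simp: sq_diff_def[abs_def]\<close>)+
      then have "integrable ?M (sq_diff G Qw n Q m)"
        "integral\<^sup>L ?M (sq_diff G Qw n Q m) \<le>
          2 * integral\<^sup>L ?M (sq_diff G Qw n Qw m) + 2 * integral\<^sup>L ?M (sq_diff G Qw m Q m)"
        by (simp_all add: sq_diff_def[abs_def])
      \<comment> \<open>With \<open>k = path_length p\<close>, this is
        \<open>2 + 2 * (3 * 2 ^ (k - 1) - 2) = 3 * 2 ^ k - 2\<close>. As subtraction on naturals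
        truncates, it relies on \<open>k\<close> being positive, which holds because
        \<open>p\<close> has at least two nodes.\<close>
      moreover have "2 * \<epsilon> + 2 * ((3 * 2 ^ (path_length p - 1) - 2) * \<epsilon>) =
          (3 * 2 ^ (path_length (a # p) - 1) - 2) * \<epsilon>"
        using Cons p by (simp add: path_length_def algebra_simps)
      ultimately show ?thesis using edge(2) IH(2) by linarith
    qed
    moreover have "integrable ?M (sq_diff G Qw n Q n)"
      "integral\<^sup>L ?M (sq_diff G Qw n Q n) \<le> integral\<^sup>L ?M (sq_diff G Qw n Q m)"
      if "integrable ?M (sq_diff G Qw n Q m)"
      using true_Q_error_le[OF scg cost_integrable, of m X "Q m" "Q n" "Qw n"] that
        e nodes Qw[OF nodes(1)] true_Q[OF nodes(1)] true_Q[OF nodes(2)] unfolding n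
      by (simp_all add: sq_diff_def[abs_def] del: scope.simps true_Q.simps)
    ultimately show ?case by auto
  qed
  show ?thesis
  proof (intro allI impI)
    fix n p
    assume "n \<in> bq_nodes G \<and> directed_path ((bq_edges G)\<inverse>) n p None \<and> path_length p \<ge> 1"
    then show "integrable (marginal G (closed_ancestors G n)) (sq_diff G Qw n Q n) \<and>
        integral\<^sup>L (marginal G (closed_ancestors G n)) (sq_diff G Qw n Q n)
          \<le> (3 * 2 ^ (path_length p - 1) - 2) * \<epsilon>"
      using error[of n p] marginal_sq_diff[where m=n and n=n and q=Qw and q'=Q,
          OF scg closed_ancestors_subset_vars[OF scg]
          scope_subset_closed_ancestors Qw scope_subset_closed_ancestors Q] by auto
  qed
qed

end
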